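(* For each integer $n\ge 64$ there is a unit rectangle visibility graph on $n$ vertices with at least $6n-12\lfloor\sqrt{n}\,\rfloor+6$ edges.
   Context: A finite simple graph $G$ is a unit rectangle visibility graph (URVG) if its vertices $v$ can be represented by closed unit squares $S_v$ in the plane with sides parallel to the coordinate axes and with pairwise disjoint interiors (squares may touch along their boundaries), in such a way that two distinct vertices $v,w$ are adjacent if and only if there is an unobstructed non-degenerate (positive width) horizontal or vertical band of visibility joining $S_v$ and $S_w$. Here a horizontal band of visibility joining $S_v$ and $S_w$ is given by an open interval $I$ of positive length such that for every $y_0\in I$ the line $y=y_0$ meets the interiors of both $S_v$ and $S_w$, and the part of this line between $S_v$ and $S_w$ (possibly a single point if the squares touch) meets the interior of no other square of the representation; vertical bands are defined analogously with the roles of $x$ and $y$ exchanged. *)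

theory Defs
  imports "HOL-Analysis.Analysis"
begin

definition simple_graph :: "'a set \<Rightarrow> 'a set set \<Rightarrow> bool" where
  "simple_graph V E \<longleftrightarrow> finite V \<and> (\<forall>e\<in>E. e \<subseteq> V \<and> card e = 2)"

definition unit_square :: "(real \<times> real) set \<Rightarrow> bool" where
  "unit_square A \<longleftrightarrow> (\<exists>a b. A = cbox (a, b) (a + 1, b + 1))"

text \<open>The part of the line \<open>y = t\<close> between \<open>A\<close> and \<open>B\<close>: the points of that line lying weakly to
  one side of all of \<open>A\<close> and weakly to the other side of all of \<open>B\<close>. It is only used for lines
  meeting the interiors of two squares with disjoint interiors, where it is the closed segment from
  the right side of the left square to the left side of the right square; this is a single point
  if the squares touch.\<close>

definition h_between :: "(real \<times> real) set \<Rightarrow> (real \<times> real) set \<Rightarrow> real \<Rightarrow> (real \<times> real) set" where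
  "h_between A B t =
     {(x, y). y = t \<and>
        ((\<forall>a b. (a, t) \<in> A \<longrightarrow> (b, t) \<in> B \<longrightarrow> a \<le> x \<and> x \<le> b) \<or>
         (\<forall>a b. (a, t) \<in> A \<longrightarrow> (b, t) \<in> B \<longrightarrow> b \<le> x \<and> x \<le> a))}"

definition v_between :: "(real \<times> real) set \<Rightarrow> (real \<times> real) set \<Rightarrow> real \<Rightarrow> (real \<times> real) set" where
  "v_between A B t =
     {(x, y). x = t \<and>
        ((\<forall>a b. (t, a) \<in> A \<longrightarrow> (t, b) \<in> B \<longrightarrow> a \<le> y \<and> y \<le> b) \<or>
         (\<forall>a b. (t, a) \<in> A \<longrightarrow> (t, b) \<in> B \<longrightarrow> b \<le> y \<and> y \<le> a))}"

definition h_visible :: "'a set \<Rightarrow> ('a \<Rightarrow> (real \<times> real) set) \<Rightarrow> 'a \<Rightarrow> 'a \<Rightarrow> bool" where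
  "h_visible V S v w \<longleftrightarrow>
     (\<exists>c d. c < d \<and>
       (\<forall>t\<in>{c<..<d}.
          {(x, y). y = t} \<inter> interior (S v) \<noteq> {} \<and>
          {(x, y). y = t} \<inter> interior (S w) \<noteq> {} \<and>
          (\<forall>u\<in>V - {v, w}. h_between (S v) (S w) t \<inter> interior (S u) = {})))"

definition v_visible :: "'a set \<Rightarrow> ('a \<Rightarrow> (real \<times> real) set) \<Rightarrow> 'a \<Rightarrow> 'a \<Rightarrow> bool" where
  "v_visible V S v w \<longleftrightarrow>
     (\<exists>c d. c < d \<and>
       (\<forall>t\<in>{c<..<d}.
          {(x, y). x = t} \<inter> interior (S v) \<noteq> {} \<and>
          {(x, y). x = t} \<inter> interior (S w) \<noteq> {} \<and>
          (\<forall>u\<in>V - {v, w}. v_between (S v) (S w) t \<inter> interior (S u) = {})))"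

definition URV_representation ::
    "'a set \<Rightarrow> 'a set set \<Rightarrow> ('a \<Rightarrow> (real \<times> real) set) \<Rightarrow> bool" where
  "URV_representation V E S \<longleftrightarrow>
     (\<forall>v\<in>V. unit_square (S v)) \<and>
     (\<forall>v\<in>V. \<forall>w\<in>V. v \<noteq> w \<longrightarrow> interior (S v) \<inter> interior (S w) = {}) \<and>
     (\<forall>v\<in>V. \<forall>w\<in>V. v \<noteq> w \<longrightarrow> ({v, w} \<in> E \<longleftrightarrow> h_visible V S v w \<or> v_visible V S v w))"

definition URVG :: "'a set \<Rightarrow> 'a set set \<Rightarrow> bool" where
  "URVG V E \<longleftrightarrow> simple_graph V E \<and> (\<exists>S. URV_representation V E S)"

end

theory Submission imports Defs begin

text \<open>
  Place the unit square of the lattice point \<open>(i, j)\<close> at \<open>((1 + s/2) i + s j, (1 + s/2) j - s i)\<close> for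
  a small \<open>s > 0\<close>, i.e. tilt a square grid slightly and leave gaps of width about \<open>s/2\<close>. Looking up
  from a square one sees two squares of the next row and, through the gap between them, one of the
  row after that; likewise in the other directions. So every square has 12 neighbours, reached by
  the six steps \<open>(0,1), (-1,1), (-1,2), (1,0), (1,1), (2,1)\<close> and their negatives, and a \<open>k \<times> k\<close>
  block has exactly \<open>6k\<^sup>2 - 12k + 6\<close> such edges.

  Because of the tilt, a single square placed above the right end of the top row sees the whole row
  edge-on, and so does one below the left end of the bottom row; each contributes \<open>k\<close> edges rather than 6. This surplus
  of \<open>2k - 12 \<ge> 4\<close> pays for two additional columns of \<open>k - 1\<close> squares, in each of which the first
  square contributes 4 edges and every later one 6. In this way all \<open>n \<le> k\<^sup>2 + 2k\<close> are reached.
\<close>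

section \<open>Graphs represented by squares\<close>

text \<open>Visibility depends only on the squares, so relabelling vertices along an injection
  changes nothing. This carries lattice points over to natural numbers.\<close>

lemma URVG_inj_image:
  assumes "URVG V E" "inj_on f V"
  shows "URVG (f ` V) ((`) f ` E)" "card ((`) f ` E) = card E"
proof -
  obtain S where G: "simple_graph V E" and S: "URV_representation V E S"
    using assms(1) unfolding URVG_def by blast
  have sub: "e \<subseteq> V" "card e = 2" if "e \<in> E" for e
    using G that by (auto simp: simple_graph_def)
  have inj: "inj_on ((`) f) E"
    by (rule inj_on_subset[OF inj_on_image_Pow[OF assms(2)]]) (use sub in blast)
  then show "card ((`) f ` E) = card E" by (rule card_image)
  \<comment> \<open>Each new label inherits the square of its unique preimage.\<close>
  define S' where "S' = S \<circ> inv_into V f"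
  have S': "S' (f v) = S v" if "v \<in> V" for v
    using that assms(2) by (simp add: S'_def)
  have diff: "f ` V - {f v, f w} = f ` (V - {v, w})" if "v \<in> V" "w \<in> V" for v w
    using that assms(2) by (auto simp: inj_on_def)
  have vis: "h_visible (f ` V) S' (f v) (f w) = h_visible V S v w"
    "v_visible (f ` V) S' (f v) (f w) = v_visible V S v w" if "v \<in> V" "w \<in> V" for v w
    using that by (simp_all add: h_visible_def v_visible_def diff S')
  have edge: "{f v, f w} \<in> (`) f ` E \<longleftrightarrow> {v, w} \<in> E" if "v \<in> V" "w \<in> V" for v w
  proof
    assume "{f v, f w} \<in> (`) f ` E"
    then obtain e where e: "e \<in> E" "f ` {v, w} = f ` e" by auto
    then have "{v, w} = e"
      using inj_on_image_eq_iff[OF assms(2), of "{v, w}" e] sub that by auto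
    then show "{v, w} \<in> E" using e by simp
  next
    assume "{v, w} \<in> E"
    then have "f ` {v, w} \<in> (`) f ` E" by (rule imageI)
    then show "{f v, f w} \<in> (`) f ` E" by simp
  qed
  have "URV_representation (f ` V) ((`) f ` E) S'"
    using S assms(2) unfolding URV_representation_def
    by (simp add: S' vis edge inj_on_eq_iff)
  moreover have "simple_graph (f ` V) ((`) f ` E)"
    unfolding simple_graph_def
  proof (intro conjI ballI)
    show "finite (f ` V)" using G by (simp add: simple_graph_def)
    fix e assume "e \<in> (`) f ` E"
    then obtain e' where e': "e' \<in> E" "e = f ` e'" by auto
    then show "e \<subseteq> f ` V" "card e = 2"
      using sub[OF e'(1)] assms(2) by (auto simp: card_image inj_on_subset)
  qed
  ultimately show "URVG (f ` V) ((`) f ` E)"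
    unfolding URVG_def by blast
qed

lemma h_visible_commute: "h_visible V S v w = h_visible V S w v"
proof -
  have "h_between A B t = h_between B A t" for A B t
    by (auto simp: h_between_def)
  moreover have "V - {v, w} = V - {w, v}" by auto
  ultimately show ?thesis unfolding h_visible_def by (simp add: conj_left_commute)
qed

lemma v_visible_commute: "v_visible V S v w = v_visible V S w v"
proof -
  have "v_between A B t = v_between B A t" for A B t
    by (auto simp: v_between_def)
  moreover have "V - {v, w} = V - {w, v}" by auto
  ultimately show ?thesis unfolding v_visible_def by (simp add: conj_left_commute)
qed

text \<open>Taking all visible pairs as edges makes any disjoint arrangement a URVG, so a lower
  bound needs only some visible pairs. Asymmetry of \<open>R\<close> prevents an edge from being
  counted in both orientations and rules out loops.\<close>

lemma URVG_of_disjoint_squares: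
  assumes fin: "finite V" and sq: "\<And>v. v \<in> V \<Longrightarrow> unit_square (S v)"
    and disj: "\<And>v w. v \<in> V \<Longrightarrow> w \<in> V \<Longrightarrow> v \<noteq> w \<Longrightarrow> interior (S v) \<inter> interior (S w) = {}"
    and R: "R \<subseteq> V \<times> V" "asym R" "\<And>v w. (v, w) \<in> R \<Longrightarrow> h_visible V S v w \<or> v_visible V S v w"
  obtains E where "URVG V E" "card R \<le> card E"
proof -
  define E where "E = {{v, w} | v w. v \<in> V \<and> w \<in> V \<and> v \<noteq> w \<and> (h_visible V S v w \<or> v_visible V S v w)}"
  have "simple_graph V E"
    using fin by (auto simp: simple_graph_def E_def)
  moreover have "URV_representation V E S"
    unfolding URV_representation_def
    using sq disj by (auto simp: E_def doubleton_eq_iff h_visible_commute v_visible_commute)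
  moreover have "inj_on (\<lambda>(v, w). {v, w}) R"
    using \<open>asym R\<close> by (auto simp: inj_on_def doubleton_eq_iff dest: asymD)
  moreover have "(\<lambda>(v, w). {v, w}) ` R \<subseteq> E"
    using R by (fastforce simp: E_def dest: asymD)
  moreover have "finite E"
    using fin by (rule finite_subset[OF _ finite_Pow_iff[THEN iffD2], rotated]) (auto simp: E_def)
  ultimately show ?thesis
    by (intro that[of E] card_inj_on_le[of "\<lambda>(v, w). {v, w}" R E]) (auto simp: URVG_def)
qed

text \<open>Each \<open>q\<close> in \<open>N\<close> gives a pair containing \<open>p\<close>; such
  pairs are distinct for distinct \<open>q\<close>, and new because \<open>p\<close> is not in
  \<open>Q\<close>.\<close>

lemma card_related_pairs_insert:
  assumes "finite Q" "p \<notin> Q" "N \<subseteq> Q" "\<And>q. q \<in> N \<Longrightarrow> (p, q) \<in> R \<or> (q, p) \<in> R"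
  shows "card (R \<inter> Q \<times> Q) + card N \<le> card (R \<inter> insert p Q \<times> insert p Q)"
proof -
  define f where "f q = (if (p, q) \<in> R then (p, q) else (q, p))" for q
  have "inj_on f N" using assms by (auto simp: inj_on_def f_def split: if_splits)
  then have "card N = card (f ` N)" by (simp add: card_image)
  moreover have "card (R \<inter> Q \<times> Q) + card (f ` N) = card (R \<inter> Q \<times> Q \<union> f ` N)"
    using assms(2) finite_subset[OF assms(3,1)] assms(1)
    by (intro card_Un_disjoint[symmetric]) (auto simp: f_def)
  moreover have "\<dots> \<le> card (R \<inter> insert p Q \<times> insert p Q)"
    using assms by (intro card_mono) (auto simp: f_def split: if_splits)
  ultimately show ?thesis by simp
qed

section \<open>Visibility along a clear band\<close>

lemma h_visible_if_clear:
  fixes x y :: "'a \<Rightarrow> real"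
  assumes S: "\<And>v. S v = cbox (x v, y v) (x v + 1, y v + 1)"
    and pq: "x p + 1 \<le> x q" and cd: "c < d"
    and p: "y p \<le> c" "d \<le> y p + 1" and q: "y q \<le> c" "d \<le> y q + 1"
    and clear: "\<And>u. u \<in> V \<Longrightarrow> u \<noteq> p \<Longrightarrow> u \<noteq> q \<Longrightarrow>
      x u \<le> x p \<or> x q \<le> x u \<or> y u + 1 \<le> c \<or> d \<le> y u"
  shows "h_visible V S p q"
  unfolding h_visible_def
proof (intro exI conjI ballI)
  have int: "interior (S v) = {x v<..<x v + 1} \<times> {y v<..<y v + 1}" for v
    by (auto simp: S interior_cbox box_def Basis_prod_def)
  have mem: "(a, b) \<in> S v \<longleftrightarrow> x v \<le> a \<and> a \<le> x v + 1 \<and> y v \<le> b \<and> b \<le> y v + 1" for v a b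
    by (auto simp: S cbox_Pair_eq)
  fix t assume t: "t \<in> {c<..<d}"
  have "(x p + 1/2, t) \<in> {(x, y). y = t} \<inter> interior (S p)"
    "(x q + 1/2, t) \<in> {(x, y). y = t} \<inter> interior (S q)"
    using t p q by (auto simp: int)
  then show "{(x, y). y = t} \<inter> interior (S p) \<noteq> {}" "{(x, y). y = t} \<inter> interior (S q) \<noteq> {}"
    by blast+
  fix u assume u: "u \<in> V - {p, q}"
  have "x p + 1 \<le> a \<and> a \<le> x q" if "(a, b) \<in> h_between (S p) (S q) t" for a b
  proof -
    \<comment> \<open>The facing sides give the two bounds of the segment; the outer sides
      \<open>x p\<close> and \<open>x q + 1\<close> refute the disjunct of \<open>h_between\<close>
      with \<open>p\<close> and \<open>q\<close> in reversed order.\<close>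
    have *: "(x p, t) \<in> S p" "(x p + 1, t) \<in> S p" "(x q, t) \<in> S q" "(x q + 1, t) \<in> S q"
      using t p q by (auto simp: mem)
    show ?thesis
      using that *(1,4) *(2,3) pq unfolding h_between_def by fastforce
  qed
  moreover have "b = t" if "(a, b) \<in> h_between (S p) (S q) t" for a b
    using that by (simp add: h_between_def)
  \<comment> \<open>All sides have length 1, so \<open>x u \<le> x p\<close> already puts the
    interior of \<open>S u\<close> to the left of the segment, which starts at
    \<open>x p + 1\<close>.\<close>
  ultimately show "h_between (S p) (S q) t \<inter> interior (S u) = {}"
    using clear[of u] u t by (fastforce simp: int)
qed (fact cd)

lemma v_visible_if_clear:
  fixes x y :: "'a \<Rightarrow> real"
  assumes S: "\<And>v. S v = cbox (x v, y v) (x v + 1, y v + 1)"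
    and pq: "y p + 1 \<le> y q" and cd: "c < d"
    and p: "x p \<le> c" "d \<le> x p + 1" and q: "x q \<le> c" "d \<le> x q + 1"
    and clear: "\<And>u. u \<in> V \<Longrightarrow> u \<noteq> p \<Longrightarrow> u \<noteq> q \<Longrightarrow>
      y u \<le> y p \<or> y q \<le> y u \<or> x u + 1 \<le> c \<or> d \<le> x u"
  shows "v_visible V S p q"
  unfolding v_visible_def
proof (intro exI conjI ballI)
  have int: "interior (S v) = {x v<..<x v + 1} \<times> {y v<..<y v + 1}" for v
    by (auto simp: S interior_cbox box_def Basis_prod_def)
  have mem: "(a, b) \<in> S v \<longleftrightarrow> x v \<le> a \<and> a \<le> x v + 1 \<and> y v \<le> b \<and> b \<le> y v + 1" for v a b
    by (auto simp: S cbox_Pair_eq)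
  fix t assume t: "t \<in> {c<..<d}"
  have "(t, y p + 1/2) \<in> {(x, y). x = t} \<inter> interior (S p)"
    "(t, y q + 1/2) \<in> {(x, y). x = t} \<inter> interior (S q)"
    using t p q by (auto simp: int)
  then show "{(x, y). x = t} \<inter> interior (S p) \<noteq> {}" "{(x, y). x = t} \<inter> interior (S q) \<noteq> {}"
    by blast+
  fix u assume u: "u \<in> V - {p, q}"
  have "y p + 1 \<le> b \<and> b \<le> y q" if "(a, b) \<in> v_between (S p) (S q) t" for a b
  proof -
    have *: "(t, y p) \<in> S p" "(t, y p + 1) \<in> S p" "(t, y q) \<in> S q" "(t, y q + 1) \<in> S q"
      using t p q by (auto simp: mem)
    show ?thesis
      using that *(1,4) *(2,3) pq unfolding v_between_def by fastforce
  qed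
  moreover have "a = t" if "(a, b) \<in> v_between (S p) (S q) t" for a b
    using that by (simp add: v_between_def)
  ultimately show "v_between (S p) (S q) t \<inter> interior (S u) = {}"
    using clear[of u] u t by (fastforce simp: int)
qed (fact cd)

section \<open>The tilted lattice\<close>

definition lattice_x :: "real \<Rightarrow> int \<times> int \<Rightarrow> real" where
  "lattice_x s p = (1 + s / 2) * of_int (fst p) + s * of_int (snd p)"

definition lattice_y :: "real \<Rightarrow> int \<times> int \<Rightarrow> real" where
  "lattice_y s p = (1 + s / 2) * of_int (snd p) - s * of_int (fst p)"

definition lattice_square :: "real \<Rightarrow> int \<times> int \<Rightarrow> (real \<times> real) set" where
  "lattice_square s p = cbox (lattice_x s p, lattice_y s p) (lattice_x s p + 1, lattice_y s p + 1)"

definition lattice_steps :: "(int \<times> int) set" where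
  "lattice_steps = {(0, 1), (-1, 1), (-1, 2), (1, 0), (1, 1), (2, 1)}"

lemma lattice_diff:
  "lattice_x s (i, j) - lattice_x s (a, b) = (1 + s / 2) * of_int (i - a) + s * of_int (j - b)"
  "lattice_y s (i, j) - lattice_y s (a, b) = (1 + s / 2) * of_int (j - b) - s * of_int (i - a)"
  by (simp_all add: lattice_x_def lattice_y_def field_simps)

lemma interior_lattice_squares_disjoint:
  assumes "0 < s" "p \<noteq> q"
  shows "interior (lattice_square s p) \<inter> interior (lattice_square s q) = {}"
proof -
  obtain a b i j where pq: "p = (a, b)" "q = (i, j)" by (cases p, cases q)
  have far: "1 \<le> \<bar>(1 + s / 2) * of_int m + s * of_int n\<bar> \<or>
      1 \<le> \<bar>(1 + s / 2) * of_int n - s * of_int m\<bar>" if mn: "(m, n) \<noteq> (0, 0)" for m n :: int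
  proof -
    have ge: "1 \<le> (1 + s / 2) * of_int m'" if "1 \<le> m'" for m' :: int
      using mult_mono[of 1 "1 + s / 2" 1 "of_int m'"] that assms(1) by simp
    have le: "(1 + s / 2) * of_int m' \<le> -1" if "m' \<le> -1" for m' :: int
      using ge[of "- m'"] that by simp
    have s: "0 \<le> s * of_int m'" if "0 \<le> m'" for m' :: int
      using that assms(1) by simp
    have s': "s * of_int m' \<le> 0" if "m' \<le> 0" for m' :: int
      using that assms(1) by (simp add: mult_nonneg_nonpos)
    have "m \<noteq> 0 \<or> n \<noteq> 0" using mn by simp
    \<comment> \<open>Four half-open quadrants cover all nonzero displacements. In each, the two
      terms of one coordinate difference do not have opposite signs, so its leading term alone gives
      absolute value at least 1.\<close>
    then have "1 \<le> m \<and> 0 \<le> n \<or> 0 \<le> m \<and> n \<le> -1 \<or> m \<le> -1 \<and> n \<le> 0 \<or> m \<le> 0 \<and> 1 \<le> n"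
      by presburger
    then show ?thesis
      by (elim disjE conjE) (use ge le s s' in \<open>smt (verit)\<close>)+
  qed
  have "1 \<le> \<bar>lattice_x s q - lattice_x s p\<bar> \<or> 1 \<le> \<bar>lattice_y s q - lattice_y s p\<bar>"
    using far[of "i - a" "j - b"] assms(2) unfolding pq lattice_diff by auto
  then show ?thesis
    by (auto simp: lattice_square_def interior_cbox box_def Basis_prod_def)
qed

text \<open>The linear facts about \<open>I = i\<close> and \<open>A = s * i\<close>, for an integer \<open>i\<close> that is small compared with
  \<open>1 / s\<close>, which decide whether a lattice square obstructs a band; with them visibility becomes a
  question of linear arithmetic in independent real variables.\<close>

definition offset :: "real \<Rightarrow> real \<Rightarrow> real \<Rightarrow> bool" where
  "offset s I A \<longleftrightarrow> A \<le> 1 - s \<and> s - 1 \<le> A \<and>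
    (I \<le> -2 \<and> A \<le> -2 * s \<or> I = -1 \<and> A = - s \<or> I = 0 \<and> A = 0 \<or> I = 1 \<and> A = s \<or>
     I = 2 \<and> A = 2 * s \<or> 3 \<le> I \<and> 3 * s \<le> A)"

section \<open>Visibility within a finite piece of the lattice\<close>

context
  fixes s :: real and K :: int and V :: "(int \<times> int) set"
  assumes s: "0 < s" "s * (of_int K + 1) \<le> 1" and K: "2 \<le> K"
    and V: "\<And>p q. p \<in> V \<Longrightarrow> q \<in> V \<Longrightarrow> \<bar>fst q - fst p\<bar> \<le> K \<and> \<bar>snd q - snd p\<bar> \<le> K"
begin

text \<open>Multiplied out so that displacements are linear in \<open>i\<close>, \<open>j\<close>,
  \<open>s * i\<close> and \<open>s * j\<close>, the quantities that \<open>offset\<close>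
  constrains.\<close>

lemma lattice_translate:
  "lattice_x s (p + (i, j)) = lattice_x s p + (of_int i + s * of_int i / 2 + s * of_int j)"
  "lattice_y s (p + (i, j)) = lattice_y s p + (of_int j + s * of_int j / 2 - s * of_int i)"
  by (simp_all add: lattice_x_def lattice_y_def field_simps)

lemma translate_cases:
  assumes "p \<in> V" "u \<in> V" "u \<noteq> p" "u \<noteq> p + (m, n)"
  obtains i j where "u = p + (i, j)" "(i, j) \<noteq> (0, 0)" "(i, j) \<noteq> (m, n)" "\<bar>i\<bar> \<le> K" "\<bar>j\<bar> \<le> K"
  using that[of "fst u - fst p" "snd u - snd p"] assms V[OF assms(1,2)]
  by (auto simp: prod_eq_iff)

text \<open>The band limits \<open>c\<close> and \<open>d\<close> are measured from the lower side
  of \<open>p\<close>, so that only displacements from \<open>p\<close> remain.\<close>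

lemma h_visible_lattice:
  assumes p: "p \<in> V" and cd: "c < d" "0 \<le> c" "d \<le> 1"
    and pq: "1 \<le> of_int m + s * of_int m / 2 + s * of_int n"
      "of_int n + s * of_int n / 2 - s * of_int m \<le> c"
      "d \<le> of_int n + s * of_int n / 2 - s * of_int m + 1"
    and clear: "\<And>i j. p + (i, j) \<in> V \<Longrightarrow> (i, j) \<noteq> (0, 0) \<Longrightarrow> (i, j) \<noteq> (m, n) \<Longrightarrow> \<bar>i\<bar> \<le> K \<Longrightarrow> \<bar>j\<bar> \<le> K \<Longrightarrow>
        of_int i + s * of_int i / 2 + s * of_int j \<le> 0 \<or>
        of_int m + s * of_int m / 2 + s * of_int n \<le> of_int i + s * of_int i / 2 + s * of_int j \<or>
        of_int j + s * of_int j / 2 - s * of_int i + 1 \<le> c \<or>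
        d \<le> of_int j + s * of_int j / 2 - s * of_int i"
  shows "h_visible V (lattice_square s) p (p + (m, n))"
proof (rule h_visible_if_clear[OF lattice_square_def,
      where c = "lattice_y s p + c" and d = "lattice_y s p + d"])
  fix u assume u: "u \<in> V" "u \<noteq> p" "u \<noteq> p + (m, n)"
  then obtain i j where "u = p + (i, j)" "(i, j) \<noteq> (0, 0)" "(i, j) \<noteq> (m, n)" "\<bar>i\<bar> \<le> K" "\<bar>j\<bar> \<le> K"
    using translate_cases[OF p] by blast
  then show "lattice_x s u \<le> lattice_x s p \<or> lattice_x s (p + (m, n)) \<le> lattice_x s u \<or>
      lattice_y s u + 1 \<le> lattice_y s p + c \<or> lattice_y s p + d \<le> lattice_y s u"
    using clear[of i j] u(1) by (auto simp: lattice_translate)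
qed (use cd pq in \<open>simp_all add: lattice_translate\<close>)

lemma v_visible_lattice:
  assumes p: "p \<in> V" and cd: "c < d" "0 \<le> c" "d \<le> 1"
    and pq: "1 \<le> of_int n + s * of_int n / 2 - s * of_int m"
      "of_int m + s * of_int m / 2 + s * of_int n \<le> c"
      "d \<le> of_int m + s * of_int m / 2 + s * of_int n + 1"
    and clear: "\<And>i j. p + (i, j) \<in> V \<Longrightarrow> (i, j) \<noteq> (0, 0) \<Longrightarrow> (i, j) \<noteq> (m, n) \<Longrightarrow> \<bar>i\<bar> \<le> K \<Longrightarrow> \<bar>j\<bar> \<le> K \<Longrightarrow>
        of_int j + s * of_int j / 2 - s * of_int i \<le> 0 \<or>
        of_int n + s * of_int n / 2 - s * of_int m \<le> of_int j + s * of_int j / 2 - s * of_int i \<or>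
        of_int i + s * of_int i / 2 + s * of_int j + 1 \<le> c \<or>
        d \<le> of_int i + s * of_int i / 2 + s * of_int j"
  shows "v_visible V (lattice_square s) p (p + (m, n))"
proof (rule v_visible_if_clear[OF lattice_square_def,
      where c = "lattice_x s p + c" and d = "lattice_x s p + d"])
  fix u assume u: "u \<in> V" "u \<noteq> p" "u \<noteq> p + (m, n)"
  then obtain i j where "u = p + (i, j)" "(i, j) \<noteq> (0, 0)" "(i, j) \<noteq> (m, n)" "\<bar>i\<bar> \<le> K" "\<bar>j\<bar> \<le> K"
    using translate_cases[OF p] by blast
  then show "lattice_y s u \<le> lattice_y s p \<or> lattice_y s (p + (m, n)) \<le> lattice_y s u \<or>
      lattice_x s u + 1 \<le> lattice_x s p + c \<or> lattice_x s p + d \<le> lattice_x s u"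
    using clear[of i j] u(1) by (auto simp: lattice_translate)
qed (use cd pq in \<open>simp_all add: lattice_translate\<close>)

text \<open>The shift caused by the tilt, accumulated over the whole extent of \<open>V\<close>,
  stays below the side of a square.\<close>

lemma scaled_abs_le:
  fixes i :: int
  assumes "\<bar>i\<bar> \<le> K"
  shows "s * of_int i \<le> 1 - s" "s - 1 \<le> s * of_int i"
proof -
  have "s * of_int \<bar>i\<bar> \<le> s * of_int K"
    using s assms by (intro mult_left_mono) auto
  moreover have "\<bar>s * of_int i\<bar> = s * of_int \<bar>i\<bar>"
    using s by (simp add: abs_mult)
  moreover have "s * of_int K \<le> 1 - s" using s by (simp add: algebra_simps)
  ultimately show "s * of_int i \<le> 1 - s" "s - 1 \<le> s * of_int i" by linarith+
qed

lemma scaled_le: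
  fixes i m :: int
  assumes "m \<le> i"
  shows "s * of_int m \<le> s * of_int i"
  using assms s by simp

lemma offset_of_int:
  fixes i :: int
  assumes "\<bar>i\<bar> \<le> K"
  shows "offset s (of_int i) (s * of_int i)"
proof -
  consider "i \<le> -2" | "i = -1" | "i = 0" | "i = 1" | "i = 2" | "3 \<le> i" by linarith
  then show ?thesis
    unfolding offset_def
    by cases (use scaled_abs_le[OF assms] scaled_le[of i "-2"] scaled_le[of 3 i] in
      \<open>simp_all add: mult.commute\<close>)
qed

text \<open>No lattice square within distance \<open>K\<close> blocks these bands, whichever points
  belong to \<open>V\<close>; hence each step yields an edge in every configuration containing both
  ends.\<close>

lemma lattice_step_visible:
  assumes p: "p \<in> V" and d: "d \<in> lattice_steps"
  shows "h_visible V (lattice_square s) p (p + d) \<or> v_visible V (lattice_square s) p (p + d)"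
proof -
  have s2: "2 * s \<le> 1 - s" using scaled_abs_le(1)[of 2] K by simp
  consider "d = (0, 1)" | "d = (-1, 1)" | "d = (-1, 2)" | "d = (1, 0)" | "d = (1, 1)" | "d = (2, 1)"
    using d by (auto simp: lattice_steps_def)
  then show ?thesis
  proof cases
    case 1
    have clear: "J + B / 2 - A \<le> 0 \<or> 1 + s / 2 \<le> J + B / 2 - A \<or> I + A / 2 + B + 1 \<le> s \<or> 1 \<le> I + A / 2 + B"
      if "offset s I A" "offset s J B" "(I, J) \<noteq> (0, 0)" for I A J B
      using that s(1) s2 unfolding offset_def prod.inject by argo
    \<comment> \<open>Seen from the left side of \<open>p\<close>, the target occupies
      \<open>[s, 1 + s]\<close>; the band is its full overlap with \<open>p\<close>.\<close>
    have "v_visible V (lattice_square s) p (p + (0, 1))"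
    proof (rule v_visible_lattice[OF p, where c = "s" and d = "1"], goal_cases)
      case (7 i j)
      show ?case
        using clear[OF offset_of_int[OF 7(4)] offset_of_int[OF 7(5)]] 7(2) by (simp add: ac_simps)
    qed (use s s2 in simp_all)
    then show ?thesis using 1 by simp
  next
    case 2
    have clear: "J + B / 2 - A \<le> 0 \<or> 1 + 3 * s / 2 \<le> J + B / 2 - A \<or> I + A / 2 + B + 1 \<le> 0 \<or> s / 2 \<le> I + A / 2 + B"
      if "offset s I A" "offset s J B" "(I, J) \<noteq> (0, 0)" for I A J B
      using that s(1) s2 unfolding offset_def prod.inject by argo
    have "v_visible V (lattice_square s) p (p + (-1, 1))"
    proof (rule v_visible_lattice[OF p, where c = "0" and d = "s / 2"], goal_cases)
      case (7 i j)
      show ?case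
        using clear[OF offset_of_int[OF 7(4)] offset_of_int[OF 7(5)]] 7(2) by (simp add: ac_simps)
    qed (use s s2 in simp_all)
    then show ?thesis using 2 by simp
  next
    case 3
    have clear: "J + B / 2 - A \<le> 0 \<or> 2 + 2 * s \<le> J + B / 2 - A \<or> I + A / 2 + B + 1 \<le> s / 2 \<or> s \<le> I + A / 2 + B"
      if "offset s I A" "offset s J B" "(I, J) \<noteq> (0, 0)" for I A J B
      using that s(1) s2 unfolding offset_def prod.inject by argo
    \<comment> \<open>The band is the gap in the next row: the square at step \<open>(-1, 1)\<close>
      ends at \<open>s / 2\<close> and the one at \<open>(0, 1)\<close> starts at
      \<open>s\<close>.\<close>
    have "v_visible V (lattice_square s) p (p + (-1, 2))"
    proof (rule v_visible_lattice[OF p, where c = "s / 2" and d = "s"], goal_cases)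
      case (7 i j)
      show ?case
        using clear[OF offset_of_int[OF 7(4)] offset_of_int[OF 7(5)]] 7(2) by (simp add: ac_simps)
    qed (use s s2 in simp_all)
    then show ?thesis using 3 by simp
  next
    case 4
    have clear: "I + A / 2 + B \<le> 0 \<or> 1 + s / 2 \<le> I + A / 2 + B \<or> J + B / 2 - A + 1 \<le> 0 \<or> 1 - s \<le> J + B / 2 - A"
      if "offset s I A" "offset s J B" "(I, J) \<noteq> (0, 0)" for I A J B
      using that s(1) s2 unfolding offset_def prod.inject by argo
    have "h_visible V (lattice_square s) p (p + (1, 0))"
    proof (rule h_visible_lattice[OF p, where c = "0" and d = "1 - s"], goal_cases)
      case (7 i j)
      show ?case
        using clear[OF offset_of_int[OF 7(4)] offset_of_int[OF 7(5)]] 7(2) by (simp add: ac_simps)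
    qed (use s s2 in simp_all)
    then show ?thesis using 4 by simp
  next
    case 5
    have clear: "I + A / 2 + B \<le> 0 \<or> 1 + 3 * s / 2 \<le> I + A / 2 + B \<or> J + B / 2 - A + 1 \<le> 1 - s / 2 \<or> 1 \<le> J + B / 2 - A"
      if "offset s I A" "offset s J B" "(I, J) \<noteq> (0, 0)" for I A J B
      using that s(1) s2 unfolding offset_def prod.inject by argo
    have "h_visible V (lattice_square s) p (p + (1, 1))"
    proof (rule h_visible_lattice[OF p, where c = "1 - s / 2" and d = "1"], goal_cases)
      case (7 i j)
      show ?case
        using clear[OF offset_of_int[OF 7(4)] offset_of_int[OF 7(5)]] 7(2) by (simp add: ac_simps)
    qed (use s s2 in simp_all)
    then show ?thesis using 5 by simp
  next
    case 6
    have clear: "I + A / 2 + B \<le> 0 \<or> 2 + 2 * s \<le> I + A / 2 + B \<or> J + B / 2 - A + 1 \<le> 1 - s \<or> 1 - s / 2 \<le> J + B / 2 - A"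
      if "offset s I A" "offset s J B" "(I, J) \<noteq> (0, 0)" for I A J B
      using that s(1) s2 unfolding offset_def prod.inject by argo
    \<comment> \<open>The band is the gap between the top of the square at step
      \<open>(1, 0)\<close>, at height \<open>1 - s\<close>, and the bottom of the one at
      \<open>(1, 1)\<close>, at \<open>1 - s / 2\<close>.\<close>
    have "h_visible V (lattice_square s) p (p + (2, 1))"
    proof (rule h_visible_lattice[OF p, where c = "1 - s" and d = "1 - s / 2"], goal_cases)
      case (7 i j)
      show ?case
        using clear[OF offset_of_int[OF 7(4)] offset_of_int[OF 7(5)]] 7(2) by (simp add: ac_simps)
    qed (use s s2 in simp_all)
    then show ?thesis using 6 by simp
  qed
qed

section \<open>Long-range visibility along a row\<close>

lemma scaled_trichotomy:
  fixes i m :: int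
  shows "real_of_int i \<le> of_int m - 1 \<and> s * of_int i \<le> s * of_int m - s \<or>
    real_of_int i = of_int m \<and> s * of_int i = s * of_int m \<or>
    of_int m + 1 \<le> real_of_int i \<and> s * of_int m + s \<le> s * of_int i"
proof -
  consider "i \<le> m - 1" | "i = m" | "m + 1 \<le> i" by linarith
  then show ?thesis
    by cases (use scaled_le[of "m + 1" i] scaled_le[of i "m - 1"] in \<open>simp_all add: algebra_simps\<close>)
qed

text \<open>The row descends to the right by \<open>s\<close> per square, so the top strip of
  \<open>p\<close>, of height \<open>s\<close>, looks over all its right neighbours. The target, far
  enough along, has sunk into that strip.\<close>

lemma upper_row_visible:
  assumes p: "p \<in> V" and m: "3 \<le> m" "m \<le> K"
    and absent: "\<And>i. 1 \<le> i \<Longrightarrow> i < m \<Longrightarrow> p + (i, 1) \<notin> V"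
  shows "h_visible V (lattice_square s) p (p + (m, 1))"
proof -
  have m3: "3 \<le> real_of_int m" "3 * s \<le> s * of_int m" "s * of_int m \<le> 1 - s"
    using m scaled_le[of 3 m] scaled_abs_le[of m] by (simp_all add: mult.commute)
  \<comment> \<open>\<open>M\<close> and \<open>C\<close> stand for \<open>m\<close> and
    \<open>s * m\<close>. As \<open>m\<close> is not a fixed number, \<open>offset\<close> alone
    cannot compare \<open>I\<close> with \<open>M\<close>; the trichotomy supplies that.\<close>
  have clear: "I + A / 2 + B \<le> 0 \<or> M + C / 2 + s \<le> I + A / 2 + B \<or>
      J + B / 2 - A + 1 \<le> 1 - s \<or> 1 \<le> J + B / 2 - A"
    if "offset s I A" "offset s J B" "(I, J) \<noteq> (0, 0)" "3 \<le> M" "3 * s \<le> C" "C \<le> 1 - s"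
      "I \<le> M - 1 \<and> A \<le> C - s \<or> I = M \<and> A = C \<or> M + 1 \<le> I \<and> C + s \<le> A"
      "\<not> (1 \<le> I \<and> I \<le> M - 1 \<and> J = 1)" for I A J B M C
    using that s(1) unfolding offset_def prod.inject by argo
  show ?thesis
  proof (rule h_visible_lattice[OF p, where c = "1 - s" and d = "1"], goal_cases)
    case (7 i j)
    have "\<not> (1 \<le> real_of_int i \<and> real_of_int i \<le> of_int m - 1 \<and> real_of_int j = 1)"
      using 7(1) absent[of i] by auto
    then show ?case
      using clear[OF offset_of_int[OF 7(4)] offset_of_int[OF 7(5)] _ m3 scaled_trichotomy] 7(2) by simp
  qed (use s(1) m3 in \<open>simp only: of_int_1 mult_1_right; linarith\<close> | use s(1) m3 in linarith)+
qed

text \<open>Counterpart from below: the band is the bottom strip of the target, between its lower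
  side and that of its left neighbour, which lies higher by \<open>s\<close>.\<close>

lemma lower_row_visible:
  assumes p: "p \<in> V" and m: "3 \<le> m" "m \<le> K"
    and absent: "\<And>i. 1 \<le> i \<Longrightarrow> i < m \<Longrightarrow> p + (i, 0) \<notin> V"
  shows "h_visible V (lattice_square s) p (p + (m, 1))"
proof -
  have m3: "3 \<le> real_of_int m" "3 * s \<le> s * of_int m" "s * of_int m \<le> 1 - s"
    using m scaled_le[of 3 m] scaled_abs_le[of m] by (simp_all add: mult.commute)
  have clear: "I + A / 2 + B \<le> 0 \<or> M + C / 2 + s \<le> I + A / 2 + B \<or>
      J + B / 2 - A + 1 \<le> 1 + s / 2 - C \<or> 1 + 3 * s / 2 - C \<le> J + B / 2 - A"
    if "offset s I A" "offset s J B" "(I, J) \<noteq> (0, 0)" "3 \<le> M" "3 * s \<le> C" "C \<le> 1 - s"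
      "I \<le> M - 1 \<and> A \<le> C - s \<or> I = M \<and> A = C \<or> M + 1 \<le> I \<and> C + s \<le> A"
      "\<not> (1 \<le> I \<and> I \<le> M - 1 \<and> J = 0)" for I A J B M C
    using that s(1) unfolding offset_def prod.inject by argo
  show ?thesis
  proof (rule h_visible_lattice[OF p, where c = "1 + s / 2 - s * of_int m" and d = "1 + 3 * s / 2 - s * of_int m"], goal_cases)
    case (7 i j)
    have "\<not> (1 \<le> real_of_int i \<and> real_of_int i \<le> of_int m - 1 \<and> real_of_int j = 0)"
      using 7(1) absent[of i] by auto
    then show ?case
      using clear[OF offset_of_int[OF 7(4)] offset_of_int[OF 7(5)] _ m3 scaled_trichotomy] 7(2) by simp
  qed (use s(1) m3 in \<open>simp only: of_int_1 mult_1_right; linarith\<close> | use s(1) m3 in linarith)+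
qed

end

section \<open>The configuration and its edges\<close>

text \<open>The full configuration: the \<open>k \<times> k\<close> block occupies columns \<open>1\<close> to \<open>k\<close>, the two extra columns are
  \<open>0\<close> and \<open>k + 1\<close>, and \<open>(k, k)\<close>, \<open>(1, -1)\<close> are the squares that see the whole top and bottom row.\<close>

definition arena :: "int \<Rightarrow> (int \<times> int) set" where
  "arena k = {0..k + 1} \<times> {0..k - 1} \<union> {(k, k), (1, -1)}"

text \<open>The row families include one extra-column square each, \<open>(0, k - 1)\<close> and
  \<open>(k + 1, 0)\<close>. Their short-range members are also lattice steps; the union counts them
  once.\<close>

definition sightings :: "int \<Rightarrow> ((int \<times> int) \<times> (int \<times> int)) set" where
  "sightings k = {(p, q). q - p \<in> lattice_steps} \<union>
     {((i, k - 1), (k, k)) | i. 0 \<le> i \<and> i \<le> k} \<union> {((1, -1), (i, 0)) | i. 1 \<le> i \<and> i \<le> k + 1}"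

text \<open>Every pair goes to a higher row, or to the right within its row.\<close>

lemma asym_sightings: "asym (sightings k)"
  by (rule asymI) (auto simp: sightings_def lattice_steps_def)

lemma sightings_visible:
  fixes k :: int
  defines "s \<equiv> 1 / (of_int k + 2)"
  assumes k: "8 \<le> k" and V: "V \<subseteq> arena k" and pq: "(p, q) \<in> sightings k" "p \<in> V" "q \<in> V"
  shows "h_visible V (lattice_square s) p q \<or> v_visible V (lattice_square s) p q"
proof -
  \<comment> \<open>Coordinates in \<open>arena k\<close> differ by at most
    \<open>K = k + 1\<close>, and \<open>s\<close> is the largest tilt allowed for this
    \<open>K\<close>.\<close>
  have s: "0 < s" "s * (of_int (k + 1) + 1) \<le> 1" and k1: "2 \<le> k + 1"
    using k by (simp_all add: s_def field_simps)
  have diff: "\<bar>fst q - fst p\<bar> \<le> k + 1 \<and> \<bar>snd q - snd p\<bar> \<le> k + 1" if "p \<in> V" "q \<in> V" for p q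
    using subsetD[OF V that(1)] subsetD[OF V that(2)] k by (auto simp: arena_def)
  have step: ?thesis if "q - p \<in> lattice_steps"
    using lattice_step_visible[OF s k1 diff pq(2) that] by simp
  have upper: ?thesis if "p = (i, k - 1)" "q = (k, k)" "0 \<le> i" "i \<le> k" for i
  proof (cases "3 \<le> k - i")
    case True
    have "h_visible V (lattice_square s) p (p + (k - i, 1))"
      by (rule upper_row_visible[OF s k1 diff pq(2)]) (use True V that in \<open>auto simp: arena_def\<close>)
    then show ?thesis using that by simp
  next
    case False
    \<comment> \<open>The displacements \<open>(0, 1)\<close>, \<open>(1, 1)\<close>,
      \<open>(2, 1)\<close> are lattice steps.\<close>
    then have "k - i = 0 \<or> k - i = 1 \<or> k - i = 2" using that by linarith
    then show ?thesis using step that by (auto simp: lattice_steps_def)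
  qed
  have lower: ?thesis if "p = (1, -1)" "q = (i, 0)" "1 \<le> i" "i \<le> k + 1" for i
  proof (cases "3 \<le> i - 1")
    case True
    have "h_visible V (lattice_square s) p (p + (i - 1, 1))"
      by (rule lower_row_visible[OF s k1 diff pq(2)]) (use True V that in \<open>auto simp: arena_def\<close>)
    then show ?thesis using that by simp
  next
    case False
    then have "i = 1 \<or> i = 2 \<or> i = 3" using that by linarith
    then show ?thesis using step that by (auto simp: lattice_steps_def)
  qed
  show ?thesis
    using pq(1) step upper lower unfolding sightings_def by blast
qed

lemma URVG_of_arena_subset:
  assumes k: "8 \<le> k" and Q: "Q \<subseteq> arena k"
  obtains V :: "nat set" and E where "URVG V E" "card V = card Q"
    "card (sightings k \<inter> Q \<times> Q) \<le> card E"
proof -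
  define s :: real where "s = 1 / (of_int k + 2)"
  have s: "0 < s" using k by (simp add: s_def)
  have "finite Q"
    using Q by (rule finite_subset) (simp add: arena_def)
  then obtain E where E: "URVG Q E" "card (sightings k \<inter> Q \<times> Q) \<le> card E"
  proof (rule URVG_of_disjoint_squares[where S = "lattice_square s"])
    show "unit_square (lattice_square s v)" for v
      by (auto simp: unit_square_def lattice_square_def)
    show "asym (sightings k \<inter> Q \<times> Q)"
      using asym_sightings[of k] by (auto simp: asym_on_def)
  qed (use interior_lattice_squares_disjoint[OF s] sightings_visible[OF k Q] in \<open>auto simp: s_def\<close>)
  have inj: "inj_on (to_nat :: int \<times> int \<Rightarrow> nat) Q"
    by (rule inj_on_subset[OF inj_to_nat]) simp
  show ?thesis
    using that[OF URVG_inj_image(1)[OF E(1) inj]] URVG_inj_image(2)[OF E(1) inj] E(2)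
    by (simp add: card_image[OF inj])
qed

section \<open>Counting sightings as the configuration grows\<close>

definition core :: "int \<Rightarrow> (int \<times> int) set" where
  "core k = {1..k} \<times> {0..k - 1}"

definition num_sightings :: "int \<Rightarrow> (int \<times> int) set \<Rightarrow> int" where
  "num_sightings k Q = int (card (sightings k \<inter> Q \<times> Q))"

lemma num_sightings_insert:
  assumes "finite Q" "p \<notin> Q" "N \<subseteq> Q" "\<And>q. q \<in> N \<Longrightarrow> (p, q) \<in> sightings k \<or> (q, p) \<in> sightings k"
  shows "num_sightings k Q + int (card N) \<le> num_sightings k (insert p Q)"
  using card_related_pairs_insert[OF assms] by (simp add: num_sightings_def)

lemma num_sightings_core:
  assumes k: "8 \<le> k"
  shows "6 * k\<^sup>2 - 12 * k + 6 \<le> num_sightings k (core k)"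
proof -
  \<comment> \<open>The points of the block from which step \<open>d\<close> stays in the block. The
    six sizes add up to \<open>6 * (k - 1)\<^sup>2\<close>.\<close>
  define B where "B d = {max 1 (1 - fst d)..min k (k - fst d)} \<times> {0..k - 1 - snd d}" for d :: "int \<times> int"
  define f where "f = (\<lambda>(d, p). (p, p + d) :: (int \<times> int) \<times> (int \<times> int))"
  let ?T = "SIGMA d:lattice_steps. B d"
  have fin: "finite lattice_steps" by (simp add: lattice_steps_def)
  have "int (card ?T) = (\<Sum>d\<in>lattice_steps. int (card (B d)))"
    using fin by (simp add: card_SigmaI B_def)
  also have "\<dots> = 6 * k\<^sup>2 - 12 * k + 6"
    using k by (simp add: lattice_steps_def B_def card_cartesian_product power2_eq_square algebra_simps)
  finally have "6 * k\<^sup>2 - 12 * k + 6 = int (card (f ` ?T))"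
    by (subst card_image) (auto simp: inj_on_def f_def)
  also have "\<dots> \<le> num_sightings k (core k)"
    unfolding num_sightings_def of_nat_le_iff
    by (rule card_mono) (auto simp: f_def B_def core_def sightings_def lattice_steps_def)
  finally show ?thesis .
qed

text \<open>The right column grows upwards from row 0 and the left one downwards from row
  \<open>k - 1\<close>, so that every later square of a column meets six squares already
  placed.\<close>

definition wings :: "int \<Rightarrow> nat \<Rightarrow> nat \<Rightarrow> (int \<times> int) set" where
  "wings k a b = insert (1, -1) (insert (k, k) (core k)) \<union> {k + 1} \<times> {0..<int a} \<union> {0} \<times> {k - int b..<k}"

lemma finite_core: "finite (core k)"
  by (simp add: core_def)

lemma finite_wings: "finite (wings k a b)"
  by (simp add: wings_def finite_core)

lemma num_sightings_insert_top:
  assumes k: "8 \<le> k"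
  shows "num_sightings k (core k) + k \<le> num_sightings k (insert (k, k) (core k))"
proof -
  let ?N = "(\<lambda>i. (i, k - 1)) ` {1..k}"
  have "card ?N = nat k" by (subst card_image) (auto simp: inj_on_def)
  moreover have "num_sightings k (core k) + int (card ?N) \<le> num_sightings k (insert (k, k) (core k))"
    by (rule num_sightings_insert[OF finite_core]) (use k in \<open>auto simp: core_def sightings_def\<close>)
  ultimately show ?thesis using k by simp
qed

lemma num_sightings_insert_bottom:
  assumes k: "8 \<le> k"
  shows "num_sightings k (insert (k, k) (core k)) + k \<le> num_sightings k (wings k 0 0)"
proof -
  let ?N = "(\<lambda>i. (i, 0 :: int)) ` {1..k}"
  have "card ?N = nat k" by (subst card_image) (auto simp: inj_on_def)
  moreover have "num_sightings k (insert (k, k) (core k)) + int (card ?N) \<le>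
      num_sightings k (insert (1, -1) (insert (k, k) (core k)))"
    by (rule num_sightings_insert) (use k in \<open>auto simp: finite_core core_def sightings_def\<close>)
  ultimately show ?thesis using k by (simp add: wings_def)
qed

lemma wings_Suc:
  "wings k (Suc a) b = insert (k + 1, int a) (wings k a b)"
  "wings k a (Suc b) = insert (0, k - 1 - int b) (wings k a b)"
  by (auto simp: wings_def)

lemma num_sightings_right_wing:
  assumes k: "8 \<le> k" and a: "int a \<le> k - 1"
  shows "num_sightings k (wings k 0 0) + 6 * int a - 2 \<le> num_sightings k (wings k a 0)"
  using a
proof (induction a)
  case (Suc a)
  have p: "(k + 1, int a) \<notin> wings k a 0"
    by (auto simp: wings_def core_def)
  note ins = num_sightings_insert[OF finite_wings p, where k = k, folded wings_Suc]
  show ?case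
  proof (cases "a = 0")
    case True
    \<comment> \<open>Three lattice steps, and the long view from \<open>(1, -1)\<close> along the
      bottom row.\<close>
    let ?N = "{(k, 0), (k, 1), (k, 2), (1, -1)} :: (int \<times> int) set"
    have "num_sightings k (wings k a 0) + int (card ?N) \<le> num_sightings k (wings k (Suc a) 0)"
      by (rule ins) (use k True in \<open>auto simp: wings_def core_def sightings_def lattice_steps_def\<close>)
    then show ?thesis using True k by simp
  next
    case False
    let ?j = "int a"
    \<comment> \<open>In the last admissible row \<open>k - 2\<close>, the entry
      \<open>(k, ?j + 2)\<close> is the top square \<open>(k, k)\<close>.\<close>
    let ?N = "{(k, ?j), (k, ?j + 1), (k, ?j + 2), (k, ?j - 1), (k + 1, ?j - 1), (k - 1, ?j - 1)}"
    have "num_sightings k (wings k a 0) + int (card ?N) \<le> num_sightings k (wings k (Suc a) 0)"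
      by (rule ins) (use k False Suc.prems in \<open>auto simp: wings_def core_def sightings_def lattice_steps_def\<close>)
    then show ?thesis using False k Suc by simp
  qed
qed simp

lemma num_sightings_left_wing:
  assumes k: "8 \<le> k" and b: "int b \<le> k - 1"
  shows "num_sightings k (wings k a 0) + 6 * int b - 2 \<le> num_sightings k (wings k a b)"
  using b
proof (induction b)
  case (Suc b)
  have p: "(0, k - 1 - int b) \<notin> wings k a b"
    using k by (auto simp: wings_def core_def)
  note ins = num_sightings_insert[OF finite_wings p, where k = k, folded wings_Suc]
  show ?case
  proof (cases "b = 0")
    case True
    let ?N = "{(1, k - 1), (1, k - 2), (1, k - 3), (k, k)}"
    have "num_sightings k (wings k a b) + int (card ?N) \<le> num_sightings k (wings k a (Suc b))"
      by (rule ins) (use k True in \<open>auto simp: wings_def core_def sightings_def lattice_steps_def\<close>)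
    then show ?thesis using True k by simp
  next
    case False
    define j where "j = k - 1 - int b"
    have b: "int b = k - 1 - j" and j: "1 \<le> j" "j \<le> k - 2"
      using False Suc.prems by (simp_all add: j_def)
    \<comment> \<open>For \<open>j = 1\<close> the entry \<open>(1, j - 2)\<close> is the bottom
      square \<open>(1, -1)\<close>.\<close>
    let ?N = "{(1, j), (1, j - 1), (1, j - 2), (1, j + 1), (0, j + 1), (2, j + 1)} :: (int \<times> int) set"
    have "?N \<subseteq> wings k a b"
      using j k by (simp add: wings_def core_def b) linarith
    then have "num_sightings k (wings k a b) + int (card ?N) \<le> num_sightings k (wings k a (Suc b))"
      by (rule ins) (auto simp: sightings_def lattice_steps_def b)
    then show ?thesis using False k Suc by simp
  qed
qed simp

lemma card_core: "0 \<le> k \<Longrightarrow> int (card (core k)) = k\<^sup>2"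
  by (simp add: core_def card_cartesian_product power2_eq_square)

lemma card_wings:
  assumes "8 \<le> k"
  shows "int (card (wings k a b)) = k\<^sup>2 + 2 + int a + int b"
proof (induction b)
  case 0
  show ?case
  proof (induction a)
    case 0
    show ?case using assms card_core[of k] by (simp add: wings_def finite_core) (simp add: core_def)
  next
    case (Suc a)
    have "(k + 1, int a) \<notin> wings k a 0" by (auto simp: wings_def core_def)
    then show ?case using Suc by (simp add: wings_Suc finite_wings)
  qed
next
  case (Suc b)
  have "(0, k - 1 - int b) \<notin> wings k a b" using assms by (auto simp: wings_def core_def)
  then show ?case using Suc by (simp add: wings_Suc finite_wings)
qed

lemma dense_arena_subset:
  assumes k: "8 \<le> k" and r: "r \<le> 2 * nat k"
  obtains Q where "Q \<subseteq> arena k" "int (card Q) = k\<^sup>2 + int r"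
    "6 * (k\<^sup>2 + int r) - 12 * k + 6 \<le> num_sightings k Q"
proof -
  consider "r = 0" | "r = 1" | "2 \<le> r" by linarith
  then show ?thesis
  proof cases
    case 1
    show ?thesis
      by (rule that[of "core k"]) (use 1 k num_sightings_core card_core[of k] in \<open>auto simp: arena_def core_def\<close>)
  next
    case 2
    have "int (card (insert (k, k) (core k))) = k\<^sup>2 + 1"
      using k card_core[of k] by (simp add: finite_core) (simp add: core_def)
    then show ?thesis
      by (intro that[of "insert (k, k) (core k)"])
        (use 2 k num_sightings_core[OF k] num_sightings_insert_top[OF k] in \<open>auto simp: arena_def core_def\<close>)
  next
    case 3
    \<comment> \<open>Fill the right column first; since \<open>r \<le> 2 * k\<close>, what is left
      fits into the other one.\<close>
    define a where "a = min (r - 2) (nat k - 1)"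
    define b where "b = r - 2 - a"
    have ab: "int a \<le> k - 1" "int b \<le> k - 1" "int r = 2 + int a + int b"
      using 3 r k by (auto simp: a_def b_def)
    show ?thesis
    proof (rule that[of "wings k a b"])
      show "wings k a b \<subseteq> arena k"
        using ab k by (auto simp: wings_def arena_def core_def)
      show "int (card (wings k a b)) = k\<^sup>2 + int r"
        using card_wings[OF k] ab by simp
      \<comment> \<open>The two special squares bring \<open>2 * k\<close> edges against a demand of
        12, and each column costs at most 2, so \<open>2 * k - 4 \<ge> 12\<close> suffices: exactly
        \<open>k \<ge> 8\<close>.\<close>
      show "6 * (k\<^sup>2 + int r) - 12 * k + 6 \<le> num_sightings k (wings k a b)"
        using num_sightings_core[OF k] num_sightings_insert_top[OF k] num_sightings_insert_bottom[OF k]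
          num_sightings_right_wing[OF k ab(1)] num_sightings_left_wing[OF k ab(2)] ab(3) k
        by (smt (verit) distrib_left)
    qed
  qed
qed

theorem theorem6p5:
  fixes n :: nat
  assumes "n \<ge> 64"
  shows "\<exists>(V :: nat set) E. URVG V E \<and> card V = n \<and>
           int (card E) \<ge> 6 * int n - 12 * \<lfloor>sqrt (real n)\<rfloor> + 6"
proof -
  define k where "k = \<lfloor>sqrt (real n)\<rfloor>"
  have "8 \<le> sqrt (real n)"
    using assms real_le_rsqrt[of 8 "real n"] by simp
  then have k8: "8 \<le> k" by (simp add: k_def le_floor_iff)
  have "real_of_int k \<le> sqrt (real n)" "sqrt (real n) < real_of_int k + 1"
    by (simp_all add: k_def)
  then have "(real_of_int k)\<^sup>2 \<le> real n" "real n < (real_of_int k + 1)\<^sup>2"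
    using k8 power_mono[of "real_of_int k" "sqrt (real n)" 2]
      power_strict_mono[of "sqrt (real n)" "real_of_int k + 1" 2] by simp_all
  then have "real_of_int (k\<^sup>2) \<le> real_of_int (int n)" "real_of_int (int n) < real_of_int ((k + 1)\<^sup>2)"
    by simp_all
  then have "k\<^sup>2 \<le> int n" "int n < (k + 1)\<^sup>2" by (simp_all only: of_int_le_iff of_int_less_iff)
  \<comment> \<open>The excess over \<open>k\<^sup>2\<close> is at most \<open>2 * k\<close> because
    \<open>n\<close> is below the next square.\<close>
  then have "nat (int n - k\<^sup>2) \<le> 2 * nat k" and r: "int n = k\<^sup>2 + int (nat (int n - k\<^sup>2))"
    using k8 by (simp_all add: power2_eq_square algebra_simps)
  then obtain Q where Q: "Q \<subseteq> arena k" "int (card Q) = int n"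
      "6 * int n - 12 * k + 6 \<le> num_sightings k Q"
    using dense_arena_subset[OF k8] by metis
  obtain V :: "nat set" and E where "URVG V E" "card V = card Q"
      "card (sightings k \<inter> Q \<times> Q) \<le> card E"
    using URVG_of_arena_subset[OF k8 Q(1)] .
  then show ?thesis
    using Q(2,3) unfolding num_sightings_def k_def[symmetric] by (intro exI[of _ V] exI[of _ E]) simp
qed

end
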